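(* Let $W_1(k;s)$ be as defined in the context. (i) For real $k$ with $|k|>2$ and all $s\in\mathbb{C}$, $$W_1(k;-s-1) = (k^2 - 4)^{-s-\frac{1}{2}} W_1(k;s).$$ (ii) For real $k$ with $|k|<2$ and $-1<\operatorname{Re}(s)<0$, $$W_1(k;-s-1) = \cot \left(-\tfrac{\pi s}{2} \right) (4-k^2)^{-s-\frac{1}{2}} W_1(k;s).$$
   Context: For real $k$ and complex $s$, $$W_1(k;s) = \frac{1}{2 \pi i} \int_{|x|=1} \left|k + x + x^{-1} \right|^s \frac{dx}{x},$$ defined by this integral where it converges and extended to a meromorphic function of $s$ by analytic continuation. *)

theory Defs
  imports "HOL-Complex_Analysis.Complex_Analysis"
begin

(* The value 0 powr s = 0 is attained for at most two points x on the unit circle,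
   so it affects neither convergence nor the value of the integral. *)
definition W1_integrand :: "real \<Rightarrow> complex \<Rightarrow> complex \<Rightarrow> complex" where
  "W1_integrand k s x = of_real (cmod (of_real k + x + inverse x)) powr s / x"

definition W1_converges :: "real \<Rightarrow> complex \<Rightarrow> bool" where
  "W1_converges k s \<longleftrightarrow> W1_integrand k s contour_integrable_on circlepath 0 1"

definition W1_integral :: "real \<Rightarrow> complex \<Rightarrow> complex" where
  "W1_integral k s =
     1 / (2 * of_real pi * \<i>) * contour_integral (circlepath 0 1) (W1_integrand k s)"

(* The predicate nicely_meromorphic_on excludes removable singularities and gives poles the
   value 0, so by the identity theorem at most one such extension exists. *)
definition W1_continuation :: "real \<Rightarrow> complex \<Rightarrow> complex" where
  "W1_continuation k = (THE F. F nicely_meromorphic_on UNIV \<and>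
     (\<forall>s. W1_converges k s \<longrightarrow> F s = W1_integral k s))"

definition W1 :: "real \<Rightarrow> complex \<Rightarrow> complex" where
  "W1 k s = (if W1_converges k s then W1_integral k s else W1_continuation k s)"

end

(* Put D = k^2 - 4 and parametrise the unit circle, so that pi * W1 k s is the integral J(s) of
   |k + 2 cos t| powr s over [0, pi].
   For k > 2 the substitution (k + 2 cos t) (k - 2 cos p) = D, that is
   tan (p/2) = sqrt ((k - 2) / (k + 2)) tan (t/2), has dp = sqrt D / (k + 2 cos t) dt and turns J(-s-1)
   into D powr (-s-1/2) J(s).
   For |k| < 2 the hyperbolic analogue (k + 2 cosh y) (2 cos p - k) = -D turns J(-s-1) into
   (-D) powr (-s-1/2) (P + Q), where P and Q are the integrals of (k + 2 cosh y) powr s and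
   (-k + 2 cosh y) powr s over y > 0.  These occur on the two vertical sides of the half strip
   0 <= Re z <= pi, Im z <= 0 when the holomorphic function (-i (k + 2 cos z)) powr s is integrated
   along its boundary, and Cauchy's theorem for k and for -k gives
   cos (pi s / 2) J(s) = - sin (pi s / 2) (P + Q). *)
theory Submission
  imports Defs "HOL-Real_Asymp.Real_Asymp"
begin

section \<open>Substitutions of reciprocal type and the passage to an integral over [0, pi]\<close>

lemma powr_reciprocal_weight:
  fixes s :: complex and D v :: real
  assumes "D > 0" "v > 0"
  shows "of_real (sqrt D / v) * of_real (D / v) powr (- s - 1)
    = of_real D powr (- s - 1 / 2) * of_real v powr s"
proof -
  have "complex_of_real (sqrt D / v) = exp (of_real (ln D / 2 - ln v))"
    unfolding exp_of_real using assms
    by (simp add: exp_diff ln_sqrt [symmetric])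
  moreover have "complex_of_real (D / v) powr (- s - 1)
      = exp ((- s - 1) * of_real (ln D - ln v))"
    using assms by (simp add: powr_def Ln_of_real ln_div flip: of_real_divide of_real_diff)
  ultimately show ?thesis
    using assms by (simp add: powr_def Ln_of_real exp_add [symmetric] algebra_simps)
qed

text \<open>Common form of both substitutions: the Jacobian \<open>sqrt D / v\<close> times the
  transformed power \<open>(D / v) powr (- s - 1)\<close> is a constant times
  \<open>v powr s\<close>, because the exponents of v add up to s. Absolute integrability is carried
  along, so existence of the integral at exponent \<open>- s - 1\<close> follows from existence at
  s.\<close>

lemma integral_reciprocal_substitution:
  fixes g v w :: "real \<Rightarrow> real" and s :: complex
  assumes "D > 0" and S: "S \<in> sets lebesgue" and inj: "inj_on g S"
    and g: "\<And>x. x \<in> S \<Longrightarrow> (g has_field_derivative sqrt D / v x) (at x)"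
    and v: "\<And>x. x \<in> S \<Longrightarrow> v x > 0"
    and w: "\<And>x. x \<in> S \<Longrightarrow> w (g x) = D / v x"
    and int: "(\<lambda>x. complex_of_real (v x) powr s) absolutely_integrable_on S"
  shows "(\<lambda>y. complex_of_real (w y) powr (- s - 1)) absolutely_integrable_on g ` S"
    and "integral (g ` S) (\<lambda>y. complex_of_real (w y) powr (- s - 1))
      = of_real D powr (- s - 1 / 2) * integral S (\<lambda>x. of_real (v x) powr s)"
proof -
  have eq: "\<bar>sqrt D / v x\<bar> *\<^sub>R complex_of_real (w (g x)) powr (- s - 1)
      = of_real D powr (- s - 1 / 2) * of_real (v x) powr s" if "x \<in> S" for x
    using powr_reciprocal_weight [OF \<open>D > 0\<close> v [OF that], of s] w [OF that] v [OF that] \<open>D > 0\<close>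
    by (simp add: scaleR_conv_of_real)
  have "(\<lambda>x. of_real D powr (- s - 1 / 2) * complex_of_real (v x) powr s) absolutely_integrable_on S"
    by (rule set_integrable_mult_right) (use int in auto)
  then have "(\<lambda>x. \<bar>sqrt D / v x\<bar> *\<^sub>R complex_of_real (w (g x)) powr (- s - 1))
      absolutely_integrable_on S"
    by (simp only: eq cong: set_integrable_cong)
  moreover have "integral S (\<lambda>x. \<bar>sqrt D / v x\<bar> *\<^sub>R complex_of_real (w (g x)) powr (- s - 1))
      = of_real D powr (- s - 1 / 2) * integral S (\<lambda>x. of_real (v x) powr s)"
    by (subst integral_mult_right [symmetric]) (intro integral_cong eq)
  ultimately have "(\<lambda>y. complex_of_real (w y) powr (- s - 1)) absolutely_integrable_on g ` S \<and>
      integral (g ` S) (\<lambda>y. complex_of_real (w y) powr (- s - 1))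
      = of_real D powr (- s - 1 / 2) * integral S (\<lambda>x. of_real (v x) powr s)"
    using has_absolute_integral_change_of_variables_real
      [OF S has_field_derivative_at_within [OF g] inj,
       where f = "\<lambda>y. complex_of_real (w y) powr (- s - 1)"]
    by blast
  then show "(\<lambda>y. complex_of_real (w y) powr (- s - 1)) absolutely_integrable_on g ` S"
    and "integral (g ` S) (\<lambda>y. complex_of_real (w y) powr (- s - 1))
      = of_real D powr (- s - 1 / 2) * integral S (\<lambda>x. of_real (v x) powr s)"
    by auto
qed

text \<open>The integrand on the circle depends on cos t only, so the two half circles contribute J
  each and the factor 1 / (2 pi i) leaves J / pi. Existence of J also yields
  \<open>W1_converges\<close>, which selects the integral branch of \<open>W1\<close>.\<close>

lemma W1_eq_integral:
  fixes k :: real and s J :: complex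
  assumes J: "((\<lambda>t. complex_of_real \<bar>k + 2 * cos t\<bar> powr s) has_integral J) {0..pi}"
  shows "W1 k s = J / of_real pi"
proof -
  define f where "f = (\<lambda>t. complex_of_real \<bar>k + 2 * cos t\<bar> powr s)"
  have "((\<lambda>t. f (- t)) has_integral J) {-pi..- 0}"
    by (intro iffD2 [OF has_integral_reflect_real]) (use J in \<open>simp add: f_def\<close>)
  \<comment> \<open>A shift by 2 pi carries [-pi, 0] to the second half [pi, 2 pi] of the parameter
    interval.\<close>
  then have "((\<lambda>t. f (- (t - 2 * pi))) has_integral J) {pi..2 * pi}"
    using has_integral_affinity [of "\<lambda>t. f (- t)" J "- pi" 0 1 "- 2 * pi"] 
    by simp
  moreover have "f (- (t - 2 * pi)) = f t" for t
    by (simp add: f_def cos_diff)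
  ultimately have "(f has_integral J) {pi..2 * pi}"
    by simp
  then have "(f has_integral (J + J)) {0..2 * pi}"
    using J by (intro has_integral_combine [of 0 pi]) (auto simp: f_def)
  then have "((\<lambda>t. f t * \<i>) has_integral (J + J) * \<i>) {0..2 * pi}"
    by (rule has_integral_mult_left)
  \<comment> \<open>On the unit circle x + 1/x = 2 cos t and dx / x = i dt. Centre 0 and radius 1
    stay explicit to match the parametrisation of \<open>part_circlepath\<close>.\<close>
  moreover have "W1_integrand k s (0 + of_real 1 * cis t) * of_real 1 * \<i> * cis t = f t * \<i>" for t
  proof -
    have eq: "of_real k + (0 + of_real 1 * cis t) + inverse (0 + of_real 1 * cis t)
        = complex_of_real (k + 2 * cos t)"
      by (simp add: complex_eq_iff)
    show ?thesis
      unfolding W1_integrand_def eq norm_of_real f_def by simp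
  qed
  ultimately have "(W1_integrand k s has_contour_integral (J + J) * \<i>) (circlepath 0 1)"
    unfolding circlepath_def by (subst has_contour_integral_part_circlepath_iff) (simp_all only: of_real_0, simp)
  then have "W1_converges k s" and "W1_integral k s = 1 / (2 * of_real pi * \<i>) * ((J + J) * \<i>)"
    unfolding W1_converges_def W1_integral_def
    by (auto simp: has_contour_integral_integrable contour_integral_unique)
  then show ?thesis
    by (simp add: W1_def field_simps)
qed

section \<open>Half-angle formulas and the hyperbolic substitution for |k| < 2\<close>

lemma cosh_half_tanh:
  fixes y :: real
  shows "cosh y = (1 + (tanh (y / 2))\<^sup>2) / (1 - (tanh (y / 2))\<^sup>2)"
proof -
  have "cosh y = cosh (y / 2) ^ 2 + sinh (y / 2) ^ 2"
    using cosh_add [of "y / 2" "y / 2"] by (simp add: power2_eq_square)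
  moreover have "cosh (y / 2) > 0" "cosh (y / 2) ^ 2 - sinh (y / 2) ^ 2 = 1"
    by (simp_all add: cosh_square_eq)
  ultimately show ?thesis
    by (simp add: tanh_def power_divide divide_simps)
qed

lemma cos_half_tan:
  fixes t :: real
  assumes "cos (t / 2) \<noteq> 0"
  shows "cos t = (1 - (tan (t / 2))\<^sup>2) / (1 + (tan (t / 2))\<^sup>2)"
proof -
  have "cos t = cos (t / 2) ^ 2 - sin (t / 2) ^ 2"
    using cos_double [of "t / 2"] by simp
  moreover have "cos (t / 2) ^ 2 + sin (t / 2) ^ 2 = 1"
    by simp
  ultimately show ?thesis
    using assms by (simp add: tan_def power_divide divide_simps)
qed

lemma cos_double_arctan:
  fixes x :: real
  shows "cos (2 * arctan x) = (1 - x\<^sup>2) / (1 + x\<^sup>2)"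
  using cos_half_tan [of "2 * arctan x"] by (simp add: tan_arctan)

lemma tanh_artanh_real:
  fixes x :: real
  assumes "\<bar>x\<bar> < 1"
  shows "tanh (artanh x) = x"
proof -
  have eq: "exp (- 2 * artanh x) = (1 - x) / (1 + x)"
    using assms by (simp add: artanh_def exp_minus exp_ln)
  show ?thesis
    unfolding tanh_real_altdef eq using assms by (simp add: divide_simps)
qed

text \<open>Here \<open>2 * cosh y\<close> runs through the values above 2, outside the range of
  \<open>2 * cos t\<close>. With k and -k as first argument this is P and Q respectively.\<close>

definition outer_integral :: "real \<Rightarrow> complex \<Rightarrow> complex" where
  "outer_integral k s = integral {0<..} (\<lambda>y. of_real (k + 2 * cosh y) powr s)"

text \<open>Split \<open>2 * cosh y\<close> into (2 - |k|) cosh y and |k| cosh y. The second part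
  compensates k because cosh is at least 1, and in the first cosh y exceeds exp y / 2. The
  exponential growth gives integrability of negative powers.\<close>

lemma outer_lower_bound:
  fixes k y :: real
  assumes "\<bar>k\<bar> < 2" 
  shows "k + 2 * cosh y \<ge> (2 - \<bar>k\<bar>) / 2 * exp y"
proof -
  have "(2 - \<bar>k\<bar>) * cosh y \<ge> (2 - \<bar>k\<bar>) * (exp y / 2)"
    using assms by (intro mult_left_mono) (auto simp: cosh_def)
  moreover have "\<bar>k\<bar> * cosh y \<ge> \<bar>k\<bar> * 1"
    by (intro mult_left_mono) (auto simp: cosh_real_ge_1)
  moreover have "k \<ge> - \<bar>k\<bar>"
    by simp
  ultimately show ?thesis
    by (simp add: field_simps)
qed

lemma outer_pos:
  fixes k y :: real
  assumes "\<bar>k\<bar> < 2"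
  shows "k + 2 * cosh y > 0"
  using outer_lower_bound [OF assms, of y] assms
  by (smt (verit) exp_gt_zero divide_pos_pos mult_pos_pos)

lemma outer_integrable:
  assumes k: "\<bar>k\<bar> < 2" and s: "Re s < 0"
  shows "(\<lambda>y. complex_of_real (k + 2 * cosh y) powr s) absolutely_integrable_on {0<..}"
proof (rule measurable_bounded_by_integrable_imp_absolutely_integrable)
  define c where "c = (2 - \<bar>k\<bar>) / 2"
  have c: "c > 0"
    using k by (simp add: c_def)
  have ge: "k + 2 * cosh y \<ge> 0" and ne: "k + 2 * cosh y \<noteq> 0" for y
    using outer_pos [OF k, of y] by auto
  show "(\<lambda>y. complex_of_real (k + 2 * cosh y) powr s) \<in> borel_measurable (lebesgue_on {0<..})"
    using ge ne
    by (intro continuous_imp_measurable_on_sets_lebesgue continuous_intros)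
       (auto simp flip: of_real_add of_real_mult)
  \<comment> \<open>The doubled sign displays the decay rate \<open>- Re s\<close>, which is
    positive.\<close>
  have "(\<lambda>y. exp (- (- Re s) * y)) integrable_on {0..}"
    using s by (intro integrable_on_exp_minus_to_infinity) auto
  then have "(\<lambda>y. exp (- (- Re s) * y)) integrable_on {0<..}"
    by (rule integrable_spike_set) (auto intro: negligible_subset [of "{0}"])
  then show "(\<lambda>y. c powr Re s * exp (- (- Re s) * y)) integrable_on {0<..}"
    by (rule integrable_on_mult_right)
  show "norm (complex_of_real (k + 2 * cosh y) powr s) \<le> c powr Re s * exp (- (- Re s) * y)" for y
  proof -
    have "norm (complex_of_real (k + 2 * cosh y) powr s) = (k + 2 * cosh y) powr Re s"
      using outer_pos [OF k, of y] by (subst norm_powr_real_powr) (auto simp flip: of_real_add of_real_mult)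
    \<comment> \<open>As \<open>Re s\<close> is negative, the lower bound on the base becomes an
      upper bound on the power.\<close>
    also have "\<dots> \<le> (c * exp y) powr Re s"
      using outer_lower_bound [OF k, of y] s c by (intro powr_mono2') (auto simp: c_def)
    also have "\<dots> = c powr Re s * exp (- (- Re s) * y)"
      using c by (simp add: powr_def ln_mult exp_add [symmetric] algebra_simps)
    finally show ?thesis .
  qed
qed auto

text \<open>With T = tanh (y/2)^2 everything becomes rational: k + 2 cosh y = (2 + k) (1 + r^2 T) /
  (1 - T), while cos (g y) = (1 - r^2 T) / (1 + r^2 T), and (2 + k) r^2 = 2 - k. The four claims are
  the inputs of \<open>integral_reciprocal_substitution\<close> with \<open>v = k + 2 cosh\<close>
  and \<open>w = 2 cos - k\<close>.\<close>

lemma two_arctan_scaled_tanh: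
  fixes k :: real
  assumes k: "\<bar>k\<bar> < 2"
  defines "r \<equiv> sqrt ((2 - k) / (2 + k))"
  defines "g \<equiv> \<lambda>y. 2 * arctan (r * tanh (y / 2))"
  shows "(g has_field_derivative sqrt (4 - k\<^sup>2) / (k + 2 * cosh y)) (at y)"
    and "2 * cos (g y) - k = (4 - k\<^sup>2) / (k + 2 * cosh y)"
    and "inj g" and "g ` {0<..} = {0<..<arccos (k / 2)}"
proof -
  have r: "r > 0" "r\<^sup>2 = (2 - k) / (2 + k)"
    using k by (auto simp: r_def)
  have rk: "sqrt (4 - k\<^sup>2) = r * (2 + k)"
  proof (rule real_sqrt_unique)
    show "(r * (2 + k))\<^sup>2 = 4 - k\<^sup>2"
      unfolding power_mult_distrib r(2) using k by (simp add: power2_eq_square field_simps)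
  qed (use r k in auto)
  have T: "(tanh (y / 2))\<^sup>2 < 1" for y :: real
    using tanh_real_lt_1 [of "y / 2"] tanh_real_gt_neg1 [of "y / 2"] by (simp add: abs_square_less_1)
  have rT: "1 + r\<^sup>2 * (tanh (y / 2))\<^sup>2 > 0" for y
    by (rule add_pos_nonneg) auto
  have kc: "k + 2 * cosh y = (2 + k) * (1 + r\<^sup>2 * (tanh (y / 2))\<^sup>2) / (1 - (tanh (y / 2))\<^sup>2)" for y
  proof -
    have "(2 + k) * r\<^sup>2 = 2 - k"
      using k by (simp add: r(2))
    then have "(2 + k) * (1 + r\<^sup>2 * (tanh (y / 2))\<^sup>2) = (2 + k) + (2 - k) * (tanh (y / 2))\<^sup>2"
      by (simp add: distrib_left flip: mult.assoc)
    then show ?thesis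
      using T [of y] by (simp add: cosh_half_tanh [of y] field_simps)
  qed
  have D: "4 - k\<^sup>2 = (2 + k) * (2 - k)"
    by (simp add: power2_eq_square algebra_simps)
  show "(g has_field_derivative sqrt (4 - k\<^sup>2) / (k + 2 * cosh y)) (at y)"
    unfolding g_def rk kc using k T [of y] rT [of y]
    by (auto intro!: derivative_eq_intros simp: power_mult_distrib divide_simps)
  show "2 * cos (g y) - k = (4 - k\<^sup>2) / (k + 2 * cosh y)"
  proof -
    \<comment> \<open>Used with \<open>a = 2 + k\<close>, \<open>m = 2 - k\<close> and
      \<open>E = 1 + r^2 T\<close>, so that the right-hand denominator is
      \<open>k + 2 * cosh y\<close> as in \<open>kc\<close>. For E = 0 or T = 1 both sides are 0, as
      division by zero gives 0.\<close>
    have cancel: "(m - m * T) / E = (a * m) / (a * E / (1 - T))" if "a \<noteq> 0" for a m T E :: real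
    proof -
      have "m - m * T = m * (1 - T)"
        by (simp add: algebra_simps)
      then show ?thesis
        using that by (simp add: mult.assoc)
    qed
    have "2 * cos (g y) - k
        = ((2 - k) - (2 + k) * r\<^sup>2 * (tanh (y / 2))\<^sup>2) / (1 + r\<^sup>2 * (tanh (y / 2))\<^sup>2)"
      using rT [of y] by (simp add: g_def cos_double_arctan power_mult_distrib field_simps)
    also have "(2 + k) * r\<^sup>2 = 2 - k"
      using k by (simp add: r(2))
    also have "((2 - k) - (2 - k) * (tanh (y / 2))\<^sup>2) / (1 + r\<^sup>2 * (tanh (y / 2))\<^sup>2)
        = (4 - k\<^sup>2) / (k + 2 * cosh y)"
      using cancel [of "2 + k"] k by (simp add: kc D)
    finally show ?thesis .
  qed
  show "inj g"
    using r unfolding g_def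
    by (auto intro!: injI simp: arctan_eq_iff dest: arg_cong [where f = artanh] simp: artanh_tanh_real)
  have mono: "g x < g y" if "x < y" for x y
    using that r by (simp add: g_def arctan_less_iff)
  \<comment> \<open>The right end of the image: tanh tends to 1, and g tends to the zero of 2 cos p
    - k in [0, pi].\<close>
  have lim: "2 * arctan r = arccos (k / 2)"
  proof -
    have "cos (2 * arctan r) = k / 2"
      unfolding cos_double_arctan r(2) using k by (simp add: field_simps)
    moreover have "0 \<le> 2 * arctan r" "2 * arctan r \<le> pi"
      using r arctan_ubound [of r] by auto
    ultimately show ?thesis
      by (metis arccos_cos)
  qed
  show "g ` {0<..} = {0<..<arccos (k / 2)}"
  proof (intro equalityI subsetI)
    fix x assume "x \<in> g ` {0<..}"
    then obtain y where y: "y > 0" "x = g y" by auto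
    have "r * tanh (y / 2) < r * 1"
      using r tanh_real_lt_1 by (intro mult_strict_left_mono) auto
    then have "g y < 2 * arctan r"
      by (simp add: g_def arctan_less_iff)
    moreover have "g y > 0"
      using mono [OF y(1)] by (simp add: g_def)
    ultimately show "x \<in> {0<..<arccos (k / 2)}"
      using y lim by auto
  next
    fix x assume x: "x \<in> {0<..<arccos (k / 2)}"
    then have x': "0 < x / 2" "x / 2 < arctan r"
      using lim by auto
    then have bd: "x / 2 < pi / 2"
      using arctan_ubound [of r] by linarith
    then have "0 < tan (x / 2)" 
      using x' by (simp add: tan_gt_zero)
    moreover have "tan (x / 2) < r"
      using tan_monotone [of "x / 2" "arctan r"] x' arctan_ubound [of r] by (simp add: tan_arctan)
    ultimately have t: "0 < tan (x / 2) / r" "tan (x / 2) / r < 1"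
      using r by auto
    define y where "y = 2 * artanh (tan (x / 2) / r)"
    have "tanh (y / 2) = tan (x / 2) / r"
      using t by (simp add: y_def tanh_artanh_real)
    then have "tanh (y / 2) > 0" "g y = x"
      using t r bd x' by (auto simp: g_def arctan_tan)
    then show "x \<in> g ` {0<..}"
      by (intro image_eqI [of _ _ y]) auto
  qed
qed

section \<open>Reflection t -> pi - t and the case |k| > 2\<close>

lemma has_integral_reflect_pi:
  fixes f :: "real \<Rightarrow> 'a::euclidean_space"
  assumes "(f has_integral I) {a..b}"
  shows "((\<lambda>t. f (pi - t)) has_integral I) {pi - b..pi - a}"
  using has_integral_affinity [OF assms [folded box_real], of "- 1" pi]
  by (simp add: image_affinity_atLeastAtMost_diff algebra_simps)

text \<open>Since cos (pi - t) = - cos t, the reflection turns k into -k up to a sign inside the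
  absolute value.\<close>

lemma W1_reflect:
  assumes "((\<lambda>t. complex_of_real \<bar>k + 2 * cos t\<bar> powr s) has_integral J) {0..pi}"
  shows "W1 (- k) s = J / of_real pi"
  using has_integral_reflect_pi [OF assms]
  by (intro W1_eq_integral) (simp add: abs_minus_commute)

text \<open>With T = tan (t/2)^2 one has k + 2 cos t = (k + 2) (1 + r^2 T) / (1 + T) and (k + 2) r^2
  = k - 2. The tangent maps (0, pi/2) onto the positive reals, which scaling by r preserves, so g
  permutes (0, pi). The interval is open because tan (t/2) has a pole at pi.\<close>

lemma two_arctan_scaled_tan:
  fixes k :: real
  assumes k: "k > 2"
  defines "r \<equiv> sqrt ((k - 2) / (k + 2))"
  defines "g \<equiv> \<lambda>t. 2 * arctan (r * tan (t / 2))"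
  shows "t \<in> {0<..<pi} \<Longrightarrow>
      (g has_field_derivative sqrt (k\<^sup>2 - 4) / (k + 2 * cos t)) (at t)"
    and "t \<in> {0<..<pi} \<Longrightarrow> k - 2 * cos (g t) = (k\<^sup>2 - 4) / (k + 2 * cos t)"
    and "inj_on g {0<..<pi}" and "g ` {0<..<pi} = {0<..<pi}"
proof -
  have r: "r > 0" "r\<^sup>2 = (k - 2) / (k + 2)"
    using k by (auto simp: r_def)
  have rk: "sqrt (k\<^sup>2 - 4) = r * (k + 2)"
  proof (rule real_sqrt_unique)
    show "(r * (k + 2))\<^sup>2 = k\<^sup>2 - 4"
      unfolding power_mult_distrib r(2) using k by (simp add: power2_eq_square field_simps)
  qed (use r k in auto)
  have cos: "cos (t / 2) > 0" if "t \<in> {0<..<pi}" for t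
    using that by (intro cos_gt_zero_pi) auto
  have T: "1 + (tan (t / 2))\<^sup>2 > 0" for t :: real
    by (rule add_pos_nonneg) auto
  have rT: "1 + r\<^sup>2 * (tan (t / 2))\<^sup>2 > 0" for t
    by (rule add_pos_nonneg) auto
  have rk2: "(k + 2) * r\<^sup>2 = k - 2"
    using k by (simp add: r(2))
  have kc: "k + 2 * cos t = (k + 2) * (1 + r\<^sup>2 * (tan (t / 2))\<^sup>2) / (1 + (tan (t / 2))\<^sup>2)"
    if "t \<in> {0<..<pi}" for t
  proof -
    have "(k + 2) * (1 + r\<^sup>2 * (tan (t / 2))\<^sup>2) = (k + 2) + (k - 2) * (tan (t / 2))\<^sup>2"
      using rk2 by (simp add: distrib_left flip: mult.assoc)
    then show ?thesis
      using T [of t] cos [OF that] by (simp add: cos_half_tan [of t] field_simps)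
  qed
  have D: "k\<^sup>2 - 4 = (k + 2) * (k - 2)"
    by (simp add: power2_eq_square algebra_simps)
  show "(g has_field_derivative sqrt (k\<^sup>2 - 4) / (k + 2 * cos t)) (at t)"
    if t: "t \<in> {0<..<pi}"
  proof -
    \<comment> \<open>Makes the derivative of the tangent rational in \<open>tan (t / 2)\<close>, to
      be compared with \<open>kc\<close>.\<close>
    have "inverse ((cos (t / 2))\<^sup>2) = 1 + (tan (t / 2))\<^sup>2"
      using cos [OF t] by (simp add: tan_sec power_inverse)
    then show ?thesis
      unfolding g_def rk kc [OF t] using k T [of t] rT [of t] cos [OF t]
      by (auto intro!: derivative_eq_intros simp: power_mult_distrib divide_simps)
  qed
  show "k - 2 * cos (g t) = (k\<^sup>2 - 4) / (k + 2 * cos t)" if t: "t \<in> {0<..<pi}"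
  proof -
    have cancel: "(m + m * T) / E = (a * m) / (a * E / (1 + T))" if "a \<noteq> 0" for a m T E :: real
    proof -
      have "m + m * T = m * (1 + T)"
        by (simp add: algebra_simps)
      then show ?thesis
        using that by (simp add: mult.assoc)
    qed
    have "k - 2 * cos (g t)
        = ((k - 2) + (k + 2) * r\<^sup>2 * (tan (t / 2))\<^sup>2) / (1 + r\<^sup>2 * (tan (t / 2))\<^sup>2)"
      using rT [of t] by (simp add: g_def cos_double_arctan power_mult_distrib field_simps)
    also have "((k - 2) + (k + 2) * r\<^sup>2 * (tan (t / 2))\<^sup>2) / (1 + r\<^sup>2 * (tan (t / 2))\<^sup>2)
        = (k\<^sup>2 - 4) / (k + 2 * cos t)"
      using cancel [of "k + 2"] k by (simp only: kc [OF t] D rk2)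
    finally show ?thesis .
  qed
  show "inj_on g {0<..<pi}"
  proof (rule inj_onI)
    fix x y assume xy: "x \<in> {0<..<pi}" "y \<in> {0<..<pi}" and "g x = g y"
    then have "arctan (tan (x / 2)) = arctan (tan (y / 2))"
      using r by (simp add: g_def arctan_eq_iff)
    then show "x = y"
      using xy by (simp add: arctan_tan)
  qed
  show "g ` {0<..<pi} = {0<..<pi}"
  proof (intro equalityI subsetI)
    fix x assume "x \<in> g ` {0<..<pi}"
    then obtain t where t: "t \<in> {0<..<pi}" "x = g t" by auto
    then have "tan (t / 2) > 0"
      by (intro tan_gt_zero) auto
    then show "x \<in> {0<..<pi}"
      using t r arctan_ubound [of "r * tan (t / 2)"] by (auto simp: g_def)
  next
    fix x assume x: "x \<in> {0<..<pi}"
    define t where "t = 2 * arctan (tan (x / 2) / r)"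
    have "tan (x / 2) > 0"
      using x by (intro tan_gt_zero) auto
    then have "t \<in> {0<..<pi}"
      using r arctan_ubound [of "tan (x / 2) / r"] by (auto simp: t_def)
    moreover have "g t = x"
      using x r by (simp add: g_def t_def tan_arctan arctan_tan)
    ultimately show "x \<in> g ` {0<..<pi}"
      by force
  qed
qed

text \<open>For k > 2 the base k + 2 cos t is continuous and positive on [0, pi], so the integral
  exists for every s. The second claim later transfers the first one to k < -2.\<close>

lemma W1_outer_reflection:
  assumes k: "k > 2"
  shows "W1 k (- s - 1) = of_real (k\<^sup>2 - 4) powr (- s - 1 / 2) * W1 k s"
    and "W1 (- k) s = W1 k s"
proof -
  define J where "J = integral {0<..<pi} (\<lambda>t. complex_of_real (k + 2 * cos t) powr s)"
  define D where "D = k\<^sup>2 - 4"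
  have D: "D > 0"
    using k power_strict_mono [of 2 k 2] by (simp add: D_def)
  have pos: "k + 2 * cos t > 0" for t
    using k cos_ge_minus_one [of t] by linarith
  have ne: "k + 2 * cos t \<noteq> 0" and ge: "k + 2 * cos t \<ge> 0" for t
    using pos [of t] by auto
  have "continuous_on {0..pi} (\<lambda>t. complex_of_real (k + 2 * cos t) powr s)"
    using ne ge by (intro continuous_intros) (auto simp flip: of_real_add of_real_mult)
  then have "(\<lambda>t. complex_of_real (k + 2 * cos t) powr s) absolutely_integrable_on {0..pi}"
    by (rule absolutely_integrable_continuous_real)
  then have int: "(\<lambda>t. complex_of_real (k + 2 * cos t) powr s) absolutely_integrable_on {0<..<pi}"
    by (rule set_integrable_subset) auto
  then have "((\<lambda>t. complex_of_real (k + 2 * cos t) powr s) has_integral J) {0<..<pi}"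
    unfolding J_def by (intro integrable_integral set_lebesgue_integral_eq_integral(1))
  then have J: "((\<lambda>t. complex_of_real \<bar>k + 2 * cos t\<bar> powr s) has_integral J) {0..pi}"
    using ge by (simp add: has_integral_Icc_iff_Ioo)
  note sub = two_arctan_scaled_tan [OF k, folded D_def]
  have "((\<lambda>t. complex_of_real (k - 2 * cos t) powr (- s - 1)) has_integral
      of_real D powr (- s - 1 / 2) * J) {0<..<pi}"
    using integral_reciprocal_substitution
      [OF D _ sub(3) sub(1), of "\<lambda>x. k - 2 * cos x" s] sub(2) pos int
    unfolding sub(4) J_def by (auto simp: has_integral_iff set_lebesgue_integral_eq_integral(1))
  then have "((\<lambda>t. complex_of_real (k - 2 * cos t) powr (- s - 1)) has_integral
      of_real D powr (- s - 1 / 2) * J) {0..pi}"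
    by (simp add: has_integral_Icc_iff_Ioo)
  \<comment> \<open>The substitution has produced k - 2 cos; reflecting restores k + 2 cos.\<close>
  from has_integral_reflect_pi [OF this]
  have "((\<lambda>t. complex_of_real \<bar>k + 2 * cos t\<bar> powr (- s - 1)) has_integral
      of_real D powr (- s - 1 / 2) * J) {0..pi}"
    using ge by simp
  then show "W1 k (- s - 1) = of_real (k\<^sup>2 - 4) powr (- s - 1 / 2) * W1 k s"
    by (simp add: W1_eq_integral [OF J] W1_eq_integral D_def)
  show "W1 (- k) s = W1 k s"
    by (simp add: W1_eq_integral [OF J] W1_reflect [OF J])
qed

section \<open>The integral over [0, pi] for |k| < 2 in terms of the outer integrals\<close>

lemma inner_half_integral:
  assumes k: "\<bar>k\<bar> < 2" and s: "Re s < 0"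
  shows "((\<lambda>t. complex_of_real \<bar>k - 2 * cos t\<bar> powr (- s - 1)) has_integral
    of_real (4 - k\<^sup>2) powr (- s - 1 / 2) * outer_integral k s) {0..arccos (k / 2)}"
proof -
  define D where "D = 4 - k\<^sup>2"
  have D: "D > 0"
    using power_strict_mono [of "\<bar>k\<bar>" 2 2] k by (simp add: D_def)
  note sub = two_arctan_scaled_tanh [OF k, folded D_def]
  have "((\<lambda>t. complex_of_real (2 * cos t - k) powr (- s - 1)) has_integral
      of_real D powr (- s - 1 / 2) * outer_integral k s) {0<..<arccos (k / 2)}"
    using integral_reciprocal_substitution
      [OF D _ inj_on_subset [OF sub(3)] sub(1), of "{0<..}" "\<lambda>x. 2 * cos x - k" s]
      sub(2) outer_pos [OF k] outer_integrable [OF k s]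
    unfolding sub(4) outer_integral_def
    by (auto simp: has_integral_iff set_lebesgue_integral_eq_integral(1))
  \<comment> \<open>Cosine decreases on [0, pi], so 2 cos t is at least k to the left of arccos
    (k/2).\<close>
  moreover have eq: "\<bar>k - 2 * cos t\<bar> = 2 * cos t - k" if "t \<in> {0<..<arccos (k / 2)}" for t
  proof -
    have "cos (arccos (k / 2)) \<le> cos t"
      using that k arccos_lbound arccos_ubound by (intro cos_monotone_0_pi_le) auto
    then show ?thesis
      using k by simp
  qed
  ultimately have "((\<lambda>t. complex_of_real \<bar>k - 2 * cos t\<bar> powr (- s - 1)) has_integral
      of_real D powr (- s - 1 / 2) * outer_integral k s) {0<..<arccos (k / 2)}"
    by (elim has_integral_eq [rotated]) (simp only: eq)
  then show ?thesis
    by (simp add: has_integral_Icc_iff_Ioo D_def)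
qed

text \<open>The interval is cut at arccos (-k/2), the zero of k + 2 cos t. The left piece is the
  half integral for -k, the right piece the reflected one for k. This also proves convergence for
  every exponent with real part above -1.\<close>

lemma inner_integral:
  assumes k: "\<bar>k\<bar> < 2" and s: "Re s < 0"
  shows "((\<lambda>t. complex_of_real \<bar>k + 2 * cos t\<bar> powr (- s - 1)) has_integral
    of_real (4 - k\<^sup>2) powr (- s - 1 / 2) * (outer_integral k s + outer_integral (- k) s)) {0..pi}"
proof -
  have "((\<lambda>t. complex_of_real \<bar>k + 2 * cos t\<bar> powr (- s - 1)) has_integral
      of_real (4 - k\<^sup>2) powr (- s - 1 / 2) * outer_integral k s) {arccos (- (k / 2))..pi}"
    using has_integral_reflect_pi [OF inner_half_integral [OF assms]] k
    by (simp add: arccos_minus)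
  moreover have "\<bar>- k - 2 * cos t\<bar> = \<bar>k + 2 * cos t\<bar>" for t
    by linarith
  then have "((\<lambda>t. complex_of_real \<bar>k + 2 * cos t\<bar> powr (- s - 1)) has_integral
      of_real (4 - k\<^sup>2) powr (- s - 1 / 2) * outer_integral (- k) s) {0..arccos (- (k / 2))}"
    using inner_half_integral [of "- k" s] assms
    by (simp only: abs_minus_cancel power2_minus divide_minus_left)
  ultimately show ?thesis
    using k arccos_lbound [of "- (k / 2)"] arccos_ubound [of "- (k / 2)"]
    by (subst distrib_left, subst add.commute, intro has_integral_combine) auto
qed

section \<open>Complex powers and the shifted cosine on the half strip\<close>

lemma powr_ii_times:
  assumes "x \<ge> 0"
  shows "(\<i> * of_real x) powr s = exp (\<i> * of_real pi * s / 2) * of_real x powr s"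
    and "(- \<i> * of_real x) powr s = exp (- (\<i> * of_real pi * s / 2)) * of_real x powr s"
  using powr_times_real_left [of "of_real x" \<i> s] powr_times_real_left [of "of_real x" "- \<i>" s] assms
  by (simp_all add: powr_def [of \<i>] powr_def [of "- \<i>"] mult_ac)

text \<open>The modulus of \<open>z powr s\<close> differs from \<open>norm z powr Re s\<close> by
  the factor exp (- Im s Arg z), and the argument is at most pi in absolute value.\<close>

lemma norm_powr_le:
  fixes z s :: complex
  shows "norm (z powr s) \<le> exp (pi * \<bar>Im s\<bar>) * norm z powr Re s"
proof -
  have "\<bar>Im s * Arg z\<bar> \<le> \<bar>Im s\<bar> * pi"
    unfolding abs_mult using Arg_bounded [of z] by (intro mult_left_mono) auto
  then have "exp (- Im s * Arg z) \<le> exp (pi * \<bar>Im s\<bar>)"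
    by (simp add: mult.commute abs_le_iff)
  then show ?thesis
    unfolding norm_powr_complex by (subst mult.commute) (rule mult_right_mono, auto)
qed

lemma
  fixes z :: complex
  shows Re_shifted_cos: "Re (of_real k + 2 * cos z) = k + 2 * cos (Re z) * cosh (Im z)"
    and Im_shifted_cos: "Im (of_real k + 2 * cos z) = - 2 * sin (Re z) * sinh (Im z)"
  by (simp_all add: Re_cos Im_cos cosh_def sinh_def field_simps)

text \<open>With c = cos (Re z) and C = cosh (Im z) the squares differ by 4 (C - 1) (C + 1 + k c),
  which is nonnegative because |k c| \<le> 2 \<le> C + 1. For negative exponents the values on the
  real axis thus dominate those at every height.\<close>

lemma norm_shifted_cos_ge:
  fixes z :: complex
  assumes "\<bar>k\<bar> < 2"
  shows "norm (of_real k + 2 * cos z) \<ge> \<bar>k + 2 * cos (Re z)\<bar>"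
proof -
  define c C where "c = cos (Re z)" and "C = cosh (Im z)"
  have "(sin (Re z))\<^sup>2 = 1 - c\<^sup>2" "(sinh (Im z))\<^sup>2 = C\<^sup>2 - 1"
    by (simp_all add: c_def C_def sin_squared_eq sinh_square_eq)
  then have norm: "(norm (of_real k + 2 * cos z))\<^sup>2
      = (k + 2 * c * C)\<^sup>2 + 4 * (1 - c\<^sup>2) * (C\<^sup>2 - 1)"
    unfolding cmod_power2 Re_shifted_cos Im_shifted_cos
    by (simp add: c_def C_def power_mult_distrib)
  have "\<bar>k * c\<bar> \<le> 2 * 1"
    unfolding abs_mult using assms by (intro mult_mono) (auto simp: c_def)
  moreover have "C \<ge> 1"
    by (simp add: C_def cosh_real_ge_1)
  ultimately have "0 \<le> 4 * (C - 1) * (C + 1 + k * c)"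
    by (intro mult_nonneg_nonneg) auto
  also have "\<dots> = (norm (of_real k + 2 * cos z))\<^sup>2 - (k + 2 * c)\<^sup>2"
    unfolding norm by (simp add: power2_eq_square algebra_simps)
  finally have "\<bar>k + 2 * c\<bar>\<^sup>2 \<le> (norm (of_real k + 2 * cos z))\<^sup>2"
    by simp
  then show ?thesis
    unfolding c_def by (rule power2_le_imp_le) simp
qed

text \<open>In the strip k + 2 cos z lies in the closed upper half plane, and the factor -i turns
  this into the closed right half plane, which meets the branch cut only at 0. The imaginary part
  vanishes only on the vertical sides, where |2 cos z| = 2 cosh (Im z) \<ge> 2 > |k|.\<close>

lemma shifted_cos_notin_nonpos:
  fixes z :: complex
  assumes k: "\<bar>k\<bar> < 2" and z: "0 \<le> Re z" "Re z \<le> pi" "Im z < 0"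
  shows "- \<i> * (of_real k + 2 * cos z) \<notin> \<real>\<^sub>\<le>\<^sub>0"
proof
  have imag: "Im w \<le> 0 \<and> Re w = 0" if "- \<i> * w \<in> \<real>\<^sub>\<le>\<^sub>0" for w
    using that by (simp add: complex_nonpos_Reals_iff)
  assume "- \<i> * (of_real k + 2 * cos z) \<in> \<real>\<^sub>\<le>\<^sub>0"
  then have "Im (of_real k + 2 * cos z) \<le> 0" "Re (of_real k + 2 * cos z) = 0"
    using imag [of "of_real k + 2 * cos z"] by blast+
  then have Re: "k + 2 * cos (Re z) * cosh (Im z) = 0" and Im: "sin (Re z) * sinh (Im z) \<ge> 0"
    unfolding Re_shifted_cos Im_shifted_cos by auto
  have "sin (Re z) \<ge> 0"
    using z by (intro sin_ge_zero) auto
  moreover have "sinh (Im z) < 0"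
    using z by simp
  ultimately have "sin (Re z) = 0"
    using Im by (smt (verit) mult_pos_neg)
  then have "\<bar>cos (Re z)\<bar> = 1"
    using sin_zero_abs_cos_one by blast
  then have "\<bar>2 * cos (Re z) * cosh (Im z)\<bar> \<ge> 2"
    by (simp add: abs_mult cosh_real_ge_1)
  then show False
    using Re k by linarith
qed

section \<open>Cauchy's theorem on the half strip\<close>

text \<open>The strip below the real axis is convex, so g has a primitive F on it; both sides reduce
  to the values of F at the four corners. The height a > 0 keeps the rectangle away from the
  singularity on the real axis.\<close>

lemma half_strip_rectangle:
  fixes g :: "complex \<Rightarrow> complex"
  assumes g: "\<And>z. 0 \<le> Re z \<Longrightarrow> Re z \<le> c \<Longrightarrow> Im z < 0 \<Longrightarrow> g field_differentiable at z"
    and c: "0 \<le> c" and ab: "0 < a" "a \<le> b"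
  shows "integral {0..c} (\<lambda>t. g (Complex t (- a))) - integral {0..c} (\<lambda>t. g (Complex t (- b)))
    = \<i> * integral {a..b} (\<lambda>y. g (Complex c (- y))) - \<i> * integral {a..b} (\<lambda>y. g (Complex 0 (- y)))"
proof -
  define S where "S = {z. 0 \<le> Re z \<and> Re z \<le> c \<and> Im z < 0}"
  have "S = {z. 0 \<le> Re z} \<inter> {z. Re z \<le> c} \<inter> {z. Im z < 0}"
    by (auto simp: S_def)
  then have "convex S"
    by (simp add: convex_Int convex_halfspace_Re_ge convex_halfspace_Re_le convex_halfspace_Im_lt)
  moreover have "continuous_on S g"
    using g by (intro continuous_at_imp_continuous_on ballI field_differentiable_imp_continuous_at)
      (auto simp: S_def)
  ultimately obtain F where F: "\<And>z. z \<in> S \<Longrightarrow> (F has_field_derivative g z) (at z within S)"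
    using g interior_subset [of S]
    by (elim holomorphic_convex_primitive [where K = "{}"]) (auto simp: S_def)
  have horizontal: "((\<lambda>t. g (Complex t (- y))) has_integral F (Complex c (- y)) - F (Complex 0 (- y))) {0..c}"
    if "y > 0" for y
  proof (rule fundamental_theorem_of_calculus [OF c])
    fix t assume t: "t \<in> {0..c}"
    have "((\<lambda>t. Complex t (- y)) has_vector_derivative 1) (at t within {0..c})"
      unfolding Complex_eq by (auto intro!: derivative_eq_intros)
    moreover have "(F has_field_derivative g (Complex t (- y)))
        (at (Complex t (- y)) within (\<lambda>t. Complex t (- y)) ` {0..c})"
      using t that by (intro has_field_derivative_subset [OF F]) (auto simp: S_def)
    ultimately show "((\<lambda>t. F (Complex t (- y))) has_vector_derivative g (Complex t (- y)))
        (at t within {0..c})"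
      using field_vector_diff_chain_within by (fastforce simp: o_def)
  qed
  have vertical: "((\<lambda>y. - \<i> * g (Complex t (- y))) has_integral F (Complex t (- b)) - F (Complex t (- a))) {a..b}"
    if "t \<in> {0..c}" for t
  proof (rule fundamental_theorem_of_calculus [OF ab(2)])
    fix y assume y: "y \<in> {a..b}"
    have "((\<lambda>y. Complex t (- y)) has_vector_derivative - \<i>) (at y within {a..b})"
      unfolding Complex_eq by (auto intro!: derivative_eq_intros)
    moreover have "(F has_field_derivative g (Complex t (- y)))
        (at (Complex t (- y)) within (\<lambda>y. Complex t (- y)) ` {a..b})"
      using y that ab by (intro has_field_derivative_subset [OF F]) (auto simp: S_def)
    ultimately show "((\<lambda>y. F (Complex t (- y))) has_vector_derivative - \<i> * g (Complex t (- y)))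
        (at y within {a..b})"
      using field_vector_diff_chain_within by (fastforce simp: o_def)
  qed
  have "\<i> * integral {a..b} (\<lambda>y. g (Complex t (- y))) = F (Complex t (- a)) - F (Complex t (- b))"
    if "t \<in> {0..c}" for t
  proof -
    have "- \<i> * integral {a..b} (\<lambda>y. g (Complex t (- y))) = F (Complex t (- b)) - F (Complex t (- a))"
      using integral_unique [OF vertical [OF that]] by (simp only: integral_mult_right)
    then show ?thesis
      by (simp add: algebra_simps)
  qed
  from this [of 0] this [of c] show ?thesis
    using integral_unique [OF horizontal [of a]] integral_unique [OF horizontal [of b]] ab c
    by simp
qed

text \<open>Dominated convergence with the norm of f as bound. The intervals are those cut out by
  the rectangles growing to the half strip.\<close>

lemma integral_exhaust_Ioi:
  fixes f :: "real \<Rightarrow> complex"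
  assumes f: "f absolutely_integrable_on {0<..}"
  shows "(\<lambda>n. integral {inverse (real (Suc n))..real (Suc n)} f) \<longlonglongrightarrow> integral {0<..} f"
proof -
  define I where "I n = {inverse (real (Suc n))..real (Suc n)}" for n
  have I: "I n \<subseteq> {0<..}" for n
    by (auto simp: I_def intro: less_le_trans [rotated])
  have f': "f integrable_on {0<..}" "(\<lambda>x. norm (f x)) integrable_on {0<..}"
    using f unfolding absolutely_integrable_on_def by auto
  have "(\<lambda>n. integral {0<..} (\<lambda>x. if x \<in> I n then f x else 0)) \<longlonglongrightarrow> integral {0<..} f"
  proof (rule dominated_convergence(2) [OF _ f'(2)])
    fix n
    have "f integrable_on I n"
      using integrable_on_subinterval [OF f'(1)] I [of n] unfolding I_def by blast
    then show "(\<lambda>x. if x \<in> I n then f x else 0) integrable_on {0<..}"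
      using I [of n] by (simp add: integrable_restrict_Int Int_absorb2)
  next
    fix x :: real assume x: "x \<in> {0<..}"
    have "\<forall>\<^sub>F n in sequentially. inverse (real (Suc n)) < x"
      using x by (intro order_tendstoD(2) [OF LIMSEQ_inverse_real_of_nat]) auto
    moreover have "\<forall>\<^sub>F n in sequentially. x \<le> real (Suc n)"
      using eventually_ge_at_top [of "nat \<lceil>x\<rceil>"] by eventually_elim linarith
    ultimately have "\<forall>\<^sub>F n in sequentially. (if x \<in> I n then f x else 0) = f x"
      by eventually_elim (auto simp: I_def)
    then show "(\<lambda>n. if x \<in> I n then f x else 0) \<longlonglongrightarrow> f x"
      by (rule tendsto_eventually)
  qed auto
  moreover have "integral {0<..} (\<lambda>x. if x \<in> I n then f x else 0) = integral (I n) f" for n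
    using I [of n] by (simp add: integral_restrict_Int Int_absorb2)
  ultimately show ?thesis
    by (simp add: I_def)
qed

text \<open>Limit of the rectangle identity between the heights 1/(n+1) and n+1: the upper side
  approaches the real segment, the lower side disappears, and the vertical sides give the outer
  integrals with the phases of i and -i.\<close>

lemma shifted_cos_powr_half_strip:
  fixes s :: complex
  assumes k: "\<bar>k\<bar> < 2" and s: "- 1 < Re s" "Re s < 0"
  shows "((\<lambda>t. (- \<i> * of_real (k + 2 * cos t)) powr s) has_integral
    \<i> * (exp (\<i> * of_real pi * s / 2) * outer_integral (- k) s
      - exp (- (\<i> * of_real pi * s / 2)) * outer_integral k s)) {0..pi}"
proof -
  define g where "g z = (- \<i> * (of_real k + 2 * cos z)) powr s" for z :: complex
  define E where "E = exp (\<i> * of_real pi * s / 2)"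
  define E' where "E' = exp (- (\<i> * of_real pi * s / 2))"
  define C where "C = exp (pi * \<bar>Im s\<bar>)"
  \<comment> \<open>The only zero of k + 2 cos t in [0, pi]. It is removed from the domain, since
    there the dominating function takes the default value \<open>0 powr Re s = 0\<close> and bounds
    nothing.\<close>
  define t0 where "t0 = arccos (- (k / 2))"
  define a b where "a n = inverse (real (Suc n))" and "b n = real (Suc n)" for n
  have a: "a n > 0" and ab: "a n \<le> b n" and b: "b n > 0" for n
    by (auto simp: a_def b_def field_simps)
  have diff: "g field_differentiable at z"
    if "- \<i> * (of_real k + 2 * cos z) \<notin> \<real>\<^sub>\<le>\<^sub>0" for z
  proof -
    have "((\<lambda>z. (- \<i> * (of_real k + 2 * cos z)) powr s) has_field_derivative
        s * (- \<i> * (of_real k + 2 * cos z)) powr (s - 1) * (- \<i> * (2 * (- sin z)))) (at z)"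
      using that by (auto intro!: derivative_eq_intros)
    then show ?thesis
      unfolding g_def field_differentiable_def by blast
  qed
  have g_bound: "norm (g z) \<le> C * norm (of_real k + 2 * cos z) powr Re s" for z
    using norm_powr_le [of "- \<i> * (of_real k + 2 * cos z)" s]
    by (simp add: g_def C_def norm_mult)
  have t0: "k + 2 * cos t \<noteq> 0" if "t \<in> {0..pi} - {t0}" for t
  proof
    assume "k + 2 * cos t = 0"
    then have "cos t = - (k / 2)"
      by simp
    then have "t0 = t"
      unfolding t0_def using that by (metis arccos_cos atLeastAtMost_iff DiffD1)
    then show False
      using that by simp
  qed
  \<comment> \<open>Taking \<open>- Re s - 1\<close> in place of s in \<open>inner_integral\<close>
    makes the exponent \<open>Re s\<close>; the condition becomes Re s > -1. This is the
    integrability of the dominating function.\<close>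
  have "((\<lambda>t. complex_of_real \<bar>k + 2 * cos t\<bar> powr (- of_real (- Re s - 1) - 1)) has_integral
      of_real (4 - k\<^sup>2) powr (- of_real (- Re s - 1) - 1 / 2) *
      (outer_integral k (of_real (- Re s - 1)) + outer_integral (- k) (of_real (- Re s - 1)))) {0..pi}"
    using s by (intro inner_integral [OF k]) auto
  moreover have "- complex_of_real (- Re s - 1) - 1 = of_real (Re s)"
    by simp
  ultimately have "(\<lambda>t. complex_of_real \<bar>k + 2 * cos t\<bar> powr of_real (Re s)) integrable_on {0..pi}"
    by (metis has_integral_integrable)
  then have "(\<lambda>t. complex_of_real (\<bar>k + 2 * cos t\<bar> powr Re s)) integrable_on {0..pi}"
    by (simp only: powr_of_real abs_ge_zero)
  from integrable_linear [OF this bounded_linear_Re]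
  have "(\<lambda>t. \<bar>k + 2 * cos t\<bar> powr Re s) integrable_on {0..pi}"
    by (simp add: o_def)
  then have "(\<lambda>t. C * \<bar>k + 2 * cos t\<bar> powr Re s) integrable_on {0..pi}"
    by (rule integrable_on_mult_right)
  then have dom: "(\<lambda>t. C * \<bar>k + 2 * cos t\<bar> powr Re s) integrable_on {0..pi} - {t0}"
    by (rule integrable_spike_set) (auto intro: negligible_subset [of "{t0}"])
  have g_dom: "norm (g (Complex t y)) \<le> C * \<bar>k + 2 * cos t\<bar> powr Re s"
    if "t \<in> {0..pi} - {t0}" for t y
  proof -
    have "norm (of_real k + 2 * cos (Complex t y)) powr Re s \<le> \<bar>k + 2 * cos t\<bar> powr Re s"
      using norm_shifted_cos_ge [OF k, of "Complex t y"] t0 [OF that] s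
      by (intro powr_mono2') auto
    then show ?thesis
      using g_bound [of "Complex t y"] by (smt (verit) C_def exp_gt_zero mult_left_mono)
  qed
  have strip: "g field_differentiable at z" if "0 \<le> Re z" "Re z \<le> pi" "Im z < 0" for z
    using shifted_cos_notin_nonpos [OF k that] by (rule diff)
  have int: "(\<lambda>t. g (Complex t (- y))) integrable_on {0..pi} - {t0}" if "y > 0" for y
  proof -
    have "continuous_on {0..pi} (g \<circ> (\<lambda>t. Complex t (- y)))"
      using that strip
      by (intro continuous_on_compose continuous_at_imp_continuous_on ballI
          field_differentiable_imp_continuous_at)
        (auto simp: Complex_eq intro!: continuous_intros)
    then have "(\<lambda>t. g (Complex t (- y))) integrable_on {0..pi}"
      by (simp add: integrable_continuous_interval o_def)
    then show ?thesis
      by (rule integrable_spike_set) (auto intro: negligible_subset [of "{t0}"])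
  qed
  have spike: "integral ({0..pi} - {t0}) f = integral {0..pi} f" for f :: "real \<Rightarrow> complex"
    by (rule integral_spike_set) (auto intro: negligible_subset [of "{t0}"])
  have lower: "(\<lambda>n. g (Complex t (- a n))) \<longlonglongrightarrow> g (of_real t)" if "t \<in> {0..pi} - {t0}" for t
  proof -
    \<comment> \<open>For real t other than t0 the base is a nonzero imaginary number, off the
      branch cut, so g is continuous there.\<close>
    have "- \<i> * (of_real k + 2 * cos (of_real t)) = - \<i> * of_real (k + 2 * cos t)"
      by (simp add: cos_of_real)
    also have "\<dots> \<notin> \<real>\<^sub>\<le>\<^sub>0"
      using t0 [OF that] by (auto simp: complex_nonpos_Reals_iff)
    finally have "isCont g (of_real t)"
      by (intro field_differentiable_imp_continuous_at diff)
    moreover have "(\<lambda>n. Complex t (- a n)) \<longlonglongrightarrow> Complex t (- 0)"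
      unfolding a_def by (intro tendsto_Complex tendsto_intros LIMSEQ_inverse_real_of_nat)
    then have "(\<lambda>n. Complex t (- a n)) \<longlonglongrightarrow> of_real t"
      by (simp add: Complex_eq)
    ultimately show ?thesis
      by (rule isCont_tendsto_compose)
  qed
  have upper: "(\<lambda>n. g (Complex t (- b n))) \<longlonglongrightarrow> 0" for t
  proof (rule Lim_null_comparison)
    \<comment> \<open>From |cos z| \<ge> sinh b \<ge> b at depth b, together with |k| < 2.\<close>
    have "norm (of_real k + 2 * cos (Complex t (- b n))) \<ge> 2 * b n - 2" for n
    proof -
      have "b n \<le> \<bar>sinh (b n)\<bar>"
        using b [of n] real_le_abs_sinh [of "b n"] by (simp add: sinh_def exp_minus)
      then have "b n \<le> sinh (b n)"
        using b [of n] by simp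
      moreover have "(sinh (b n))\<^sup>2 \<le> (norm (cos (Complex t (- b n))))\<^sup>2"
        by (simp add: norm_cos_squared sinh_def exp_minus power_divide power2_commute)
      then have "sinh (b n) \<le> norm (cos (Complex t (- b n)))"
        by (rule power2_le_imp_le) simp
      ultimately have "2 * b n \<le> norm (2 * cos (Complex t (- b n)))"
        by (simp add: norm_mult)
      then show ?thesis
        using norm_diff_ineq [of "2 * cos (Complex t (- b n))" "of_real k"] k
        by (simp add: add.commute)
    qed
    \<comment> \<open>At n = 0 the bound \<open>2 * b n - 2\<close> is 0, whose power is 0 by
      convention; hence n > 0.\<close>
    then have top: "C * norm (of_real k + 2 * cos (Complex t (- b n))) powr Re s \<le> C * (2 * b n - 2) powr Re s"
      if "n > 0" for n
      using that s by (intro mult_left_mono powr_mono2') (auto simp: b_def C_def)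
    show "\<forall>\<^sub>F n in sequentially. norm (g (Complex t (- b n))) \<le> C * (2 * b n - 2) powr Re s"
      by (rule eventually_mono [OF eventually_gt_at_top [of 0]]) (rule order_trans [OF g_bound top])
    have "filterlim (\<lambda>n. 2 * b n - 2) at_top sequentially"
      unfolding b_def by real_asymp
    then have "(\<lambda>n. (2 * b n - 2) powr Re s) \<longlonglongrightarrow> 0"
      using s by (intro tendsto_neg_powr) auto
    then show "(\<lambda>n. C * (2 * b n - 2) powr Re s) \<longlonglongrightarrow> 0"
      by (rule tendsto_mult_right_zero)
  qed
  have L: "(\<lambda>t. g (of_real t)) integrable_on {0..pi} - {t0}"
    "(\<lambda>n. integral ({0..pi} - {t0}) (\<lambda>t. g (Complex t (- a n))))
      \<longlonglongrightarrow> integral ({0..pi} - {t0}) (\<lambda>t. g (of_real t))"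
    using dominated_convergence [OF int [OF a] dom g_dom lower] by auto
  have U: "(\<lambda>n. integral ({0..pi} - {t0}) (\<lambda>t. g (Complex t (- b n)))) \<longlonglongrightarrow> 0"
    using dominated_convergence(2) [OF int [OF b] dom g_dom upper] by simp
  have left: "g (Complex 0 (- y)) = E' * of_real (k + 2 * cosh y) powr s" for y
  proof -
    have "of_real k + 2 * cos (Complex 0 (- y)) = of_real (k + 2 * cosh y)"
      by (simp add: complex_eq_iff Re_shifted_cos Im_shifted_cos Re_cos Im_cos cosh_def)
    then show ?thesis
      unfolding g_def E'_def using outer_pos [OF k, of y] by (simp only: powr_ii_times less_imp_le)
  qed
  \<comment> \<open>On this side the cosine is -cosh y, which reverses the sign of the base: the
    phase is that of i, and k is replaced by -k.\<close>
  have right: "g (Complex pi (- y)) = E * of_real (- k + 2 * cosh y) powr s" for y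
  proof -
    have "- \<i> * (of_real k + 2 * cos (Complex pi (- y))) = \<i> * of_real (- k + 2 * cosh y)"
      by (simp add: complex_eq_iff Re_shifted_cos Im_shifted_cos Re_cos Im_cos cosh_def field_simps)
    moreover have "- k + 2 * cosh y > 0"
      using outer_pos [of "- k" y] k by simp
    ultimately show ?thesis
      unfolding g_def E_def by (simp only: powr_ii_times less_imp_le)
  qed
  have R: "(\<lambda>n. integral {a n..b n} (\<lambda>y. of_real (k + 2 * cosh y) powr s)) \<longlonglongrightarrow> outer_integral k s"
    if "\<bar>k\<bar> < 2" for k
    unfolding outer_integral_def a_def b_def
    by (rule integral_exhaust_Ioi [OF outer_integrable [OF that s(2)]])
  have "(\<lambda>n. \<i> * (E * integral {a n..b n} (\<lambda>y. of_real (- k + 2 * cosh y) powr s))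
        - \<i> * (E' * integral {a n..b n} (\<lambda>y. of_real (k + 2 * cosh y) powr s)))
      \<longlonglongrightarrow> \<i> * (E * outer_integral (- k) s) - \<i> * (E' * outer_integral k s)"
    using k by (intro tendsto_intros R) auto
  moreover have "\<i> * (E * integral {a n..b n} (\<lambda>y. of_real (- k + 2 * cosh y) powr s))
        - \<i> * (E' * integral {a n..b n} (\<lambda>y. of_real (k + 2 * cosh y) powr s))
      = integral ({0..pi} - {t0}) (\<lambda>t. g (Complex t (- a n)))
        - integral ({0..pi} - {t0}) (\<lambda>t. g (Complex t (- b n)))" for n
    using half_strip_rectangle [OF strip pi_ge_zero a [of n] ab [of n]]
    unfolding spike left right integral_mult_right by (rule sym)
  ultimately have "(\<lambda>n. integral ({0..pi} - {t0}) (\<lambda>t. g (Complex t (- a n)))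
        - integral ({0..pi} - {t0}) (\<lambda>t. g (Complex t (- b n))))
      \<longlonglongrightarrow> \<i> * (E * outer_integral (- k) s) - \<i> * (E' * outer_integral k s)"
    by simp
  with tendsto_diff [OF L(2) U]
  have "integral ({0..pi} - {t0}) (\<lambda>t. g (of_real t))
      = \<i> * (E * outer_integral (- k) s) - \<i> * (E' * outer_integral k s)"
    using LIMSEQ_unique by fastforce
  moreover have "(\<lambda>t. g (of_real t)) integrable_on {0..pi}"
    using L(1) by (rule integrable_spike_set) (auto intro: negligible_subset [of "{t0}"])
  ultimately have "((\<lambda>t. g (of_real t)) has_integral
      \<i> * (E * outer_integral (- k) s) - \<i> * (E' * outer_integral k s)) {0..pi}"
    unfolding spike by (simp add: has_integral_iff)
  then show ?thesis
    by (simp add: g_def E_def E'_def cos_of_real right_diff_distrib)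
qed

section \<open>The functional equation for |k| < 2 and the conclusion\<close>

text \<open>Adding the strip identities for k and, reflected, for -k gives the integrand (i x)^s +
  (-i x)^s with x = k + 2 cos t. This equals 2 cos (pi s/2) |x|^s, while the right-hand sides
  combine to i (E - E') (P + Q).\<close>

lemma inner_outer_integral:
  assumes k: "\<bar>k\<bar> < 2" and s: "- 1 < Re s" "Re s < 0"
    and J: "((\<lambda>t. complex_of_real \<bar>k + 2 * cos t\<bar> powr s) has_integral J) {0..pi}"
  shows "cos (of_real pi * s / 2) * J
    = - sin (of_real pi * s / 2) * (outer_integral k s + outer_integral (- k) s)"
proof -
  define E where "E = exp (\<i> * of_real pi * s / 2)"
  define E' where "E' = exp (- (\<i> * of_real pi * s / 2))"
  define P Q where "P = outer_integral k s" and "Q = outer_integral (- k) s"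
  have cos: "E + E' = 2 * cos (of_real pi * s / 2)" and sin: "\<i> * (E - E') = - 2 * sin (of_real pi * s / 2)"
    by (simp_all add: E_def E'_def cos_exp_eq sin_exp_eq field_simps)
  have "((\<lambda>t. (- \<i> * of_real (- k + 2 * cos (pi - t))) powr s) has_integral \<i> * (E * P - E' * Q)) {0..pi}"
    using has_integral_reflect_pi [OF shifted_cos_powr_half_strip [of "- k" s]] k s
    by (simp add: E_def E'_def P_def Q_def)
  moreover have "((\<lambda>t. (- \<i> * of_real (k + 2 * cos t)) powr s) has_integral \<i> * (E * Q - E' * P)) {0..pi}"
    using shifted_cos_powr_half_strip [OF k s] by (simp only: E_def E'_def P_def Q_def)
  ultimately have "((\<lambda>t. (- \<i> * of_real (- k + 2 * cos (pi - t))) powr s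
      + (- \<i> * of_real (k + 2 * cos t)) powr s) has_integral
      \<i> * (E * P - E' * Q) + \<i> * (E * Q - E' * P)) {0..pi}"
    by (rule has_integral_add)
  moreover have "(- \<i> * of_real (- k + 2 * cos (pi - t))) powr s
      + (- \<i> * of_real (k + 2 * cos t)) powr s
      = (E + E') * of_real \<bar>k + 2 * cos t\<bar> powr s" for t
  proof -
    \<comment> \<open>A change of sign of x only exchanges the two phases, so their sum is the
      same.\<close>
    have *: "(\<i> * of_real x) powr s + (- \<i> * of_real x) powr s = (E + E') * of_real \<bar>x\<bar> powr s"
      for x :: real
    proof (cases "x \<ge> 0")
      case True
      then show ?thesis
        unfolding powr_ii_times [OF True] by (simp add: E_def E'_def distrib_right)
    next
      case False
      then have x: "- x \<ge> 0"
        by simp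
      have "\<i> * of_real x = - \<i> * of_real (- x)" "- \<i> * of_real x = \<i> * of_real (- x)"
        by simp_all
      then have "(\<i> * of_real x) powr s + (- \<i> * of_real x) powr s = (E' + E) * of_real (- x) powr s"
        by (simp only: powr_ii_times [OF x] E_def E'_def distrib_right)
      then show ?thesis
        using False by (simp add: add.commute)
    qed
    have "- \<i> * of_real (- k + 2 * cos (pi - t)) = \<i> * of_real (k + 2 * cos t)"
      by (simp add: algebra_simps)
    then show ?thesis
      using * [of "k + 2 * cos t"] by simp
  qed
  ultimately have "((\<lambda>t. (E + E') * of_real \<bar>k + 2 * cos t\<bar> powr s) has_integral
      \<i> * (E * P - E' * Q) + \<i> * (E * Q - E' * P)) {0..pi}"
    by simp
  with has_integral_mult_right [OF J, of "E + E'"]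
  have "(E + E') * J = \<i> * (E * P - E' * Q) + \<i> * (E * Q - E' * P)"
    by (rule has_integral_unique)
  also have "\<dots> = \<i> * (E - E') * (P + Q)"
    by (simp add: algebra_simps)
  finally show ?thesis
    unfolding cos sin P_def Q_def by (simp add: mult_ac)
qed

lemma W1_inner_reflection:
  assumes k: "\<bar>k\<bar> < 2" and s: "- 1 < Re s" "Re s < 0"
  shows "W1 k (- s - 1) =
    cot (- (of_real pi * s / 2)) * of_real (4 - k\<^sup>2) powr (- s - 1 / 2) * W1 k s"
proof -
  define z where "z = of_real pi * s / 2"
  \<comment> \<open>The exponent is right because - (- s - 1) - 1 = s, and Re (- s - 1) < 0 by the
    lower bound on Re s.\<close>
  obtain J where J: "((\<lambda>t. complex_of_real \<bar>k + 2 * cos t\<bar> powr s) has_integral J) {0..pi}"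
    using inner_integral [OF k, of "- s - 1"] s by auto
  have "sin z \<noteq> 0"
  proof
    assume "sin z = 0"
    then obtain n :: int where "z = of_real (of_int n * pi)"
      by (auto simp: sin_eq_0)
    \<comment> \<open>A zero of the sine would make Re s an even integer strictly between -1 and
      0.\<close>
    then have "Re s = 2 * of_int n"
      by (auto simp: z_def complex_eq_iff)
    then have "real_of_int (- 1) < real_of_int (2 * n)" "real_of_int (2 * n) < real_of_int 0"
      using s by simp_all
    then show False
      unfolding of_int_less_iff by presburger
  qed
  moreover have "cot (- z) * J = - (cos z * J) / sin z"
    by (simp add: cot_def)
  ultimately have "outer_integral k s + outer_integral (- k) s = cot (- z) * J"
    using inner_outer_integral [OF k s J, folded z_def] by simp
  then show ?thesis
    unfolding W1_eq_integral [OF inner_integral [OF k s(2)]] W1_eq_integral [OF J] z_def [symmetric]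
    by (simp add: mult_ac)
qed

theorem theorem1p2:
  shows "(\<forall>(k::real) (s::complex). \<bar>k\<bar> > 2 \<longrightarrow>
            W1 k (- s - 1) = of_real (k\<^sup>2 - 4) powr (- s - 1 / 2) * W1 k s) \<and>
         (\<forall>(k::real) (s::complex). \<bar>k\<bar> < 2 \<and> - 1 < Re s \<and> Re s < 0 \<longrightarrow>
            W1 k (- s - 1) =
              cot (- (of_real pi * s / 2)) * of_real (4 - k\<^sup>2) powr (- s - 1 / 2) * W1 k s)"
proof (intro conjI allI impI)
  fix k :: real and s :: complex
  assume "\<bar>k\<bar> > 2"
  then consider "k > 2" | "- k > 2"
    by linarith
  then show "W1 k (- s - 1) = of_real (k\<^sup>2 - 4) powr (- s - 1 / 2) * W1 k s"
  proof cases
    case 1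
    then show ?thesis
      by (rule W1_outer_reflection)
  next
    case 2
    \<comment> \<open>The identity for -k carries over because \<open>W1\<close> is even in k at
      both s and \<open>- s - 1\<close>, and so is k^2 - 4.\<close>
    show ?thesis
      using W1_outer_reflection(1) [OF 2, of s] W1_outer_reflection(2) [OF 2, of s]
        W1_outer_reflection(2) [OF 2, of "- s - 1"]
      by simp
  qed
next
  fix k :: real and s :: complex
  assume "\<bar>k\<bar> < 2 \<and> - 1 < Re s \<and> Re s < 0"
  then show "W1 k (- s - 1) =
      cot (- (of_real pi * s / 2)) * of_real (4 - k\<^sup>2) powr (- s - 1 / 2) * W1 k s"
    by (intro W1_inner_reflection) auto
qed

end
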